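(* Let $\psi(z)=\sum_{k=0}^{\infty}\beta_kz^k$ be holomorphic in the open unit disk $\mathbb{D}$ with $\beta_0\neq0$, and let $F\in\mathcal{A}_{\mathrm{Id},\psi}$. Then for every $\lambda\in\mathbb{C}$ we have $$|\Phi_2(F,\lambda)|\leq\max\left(\left|\Phi_1(\psi,\lambda)\right|,\ |1-\lambda||\beta_1\beta_2|+\frac{C(\beta_1,\lambda)}{2},\ C(\beta_1,\lambda)\right),$$ where $C(\beta_1,\lambda):=|\beta_1|^2\max(1,|\lambda|)$.
   Context: $\mathcal{A}_{\mathrm{Id},\psi}$ is the class of functions $F$ holomorphic in $\mathbb{D}$ of the form $F(z)=z\psi(\omega(z))$, $z\in\mathbb{D}$, for some holomorphic self-mapping $\omega$ of $\mathbb{D}$ with $\omega(0)=0$. For $f(z)=\sum_{k=0}^\infty f_kz^k$, $\lambda\in\mathbb{C}$ and $n=0,1,2,\ldots$, $\Phi_n(f,\lambda):=f_nf_{n+2}-\lambda f_{n+1}^2$; thus $\Phi_2(F,\lambda)=a_2a_4-\lambda a_3^2$ for $F(z)=\sum_k a_kz^k$, and $\Phi_1(\psi,\lambda)=\beta_1\beta_3-\lambda\beta_2^2$. *)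

theory Defs
  imports "HOL-Complex_Analysis.Complex_Analysis"
begin

abbreviation unit_disk :: "complex set" where
  "unit_disk \<equiv> ball 0 1"

(* Only the values on the unit disk are constrained: a function on the disk is
   represented by a total function whose values elsewhere are irrelevant. *)
definition class_A_Id :: "(complex \<Rightarrow> complex) \<Rightarrow> (complex \<Rightarrow> complex) set" where
  "class_A_Id \<psi> =
     {F. F holomorphic_on unit_disk \<and>
         (\<exists>\<omega>. \<omega> holomorphic_on unit_disk \<and> \<omega> ` unit_disk \<subseteq> unit_disk \<and> \<omega> 0 = 0 \<and>
              (\<forall>z\<in>unit_disk. F z = z * \<psi> (\<omega> z)))}"

definition taylor_coeff :: "(complex \<Rightarrow> complex) \<Rightarrow> nat \<Rightarrow> complex" where
  "taylor_coeff f k = fps_nth (fps_expansion f 0) k"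

definition Phi :: "nat \<Rightarrow> (complex \<Rightarrow> complex) \<Rightarrow> complex \<Rightarrow> complex" where
  "Phi n f lam = taylor_coeff f n * taylor_coeff f (n + 2) - lam * (taylor_coeff f (n + 1))\<^sup>2"

definition C_const :: "complex \<Rightarrow> complex \<Rightarrow> real" where
  "C_const b lam = (norm b)\<^sup>2 * max 1 (norm lam)"

end

theory Submission
  imports Defs
begin

text \<open>
  Write \<open>\<omega>(z) = z \<phi>(z)\<close>; by the Schwarz lemma \<open>\<phi>\<close> is bounded by \<open>1\<close> on the disk. Let
  \<open>\<phi>(z) = c\<^sub>0 + c\<^sub>1 z + c\<^sub>2 z\<^sup>2 + \<dots>\<close>. Expanding \<open>F(z) = z \<psi>(z \<phi>(z))\<close> gives
  \<open>\<Phi>\<^sub>2(F,\<lambda>) = \<Phi>\<^sub>1(\<psi>,\<lambda>) c\<^sub>0\<^sup>4 + 2(1-\<lambda>) \<beta>\<^sub>1\<beta>\<^sub>2 c\<^sub>0\<^sup>2c\<^sub>1 + \<beta>\<^sub>1\<^sup>2 (c\<^sub>0c\<^sub>2 - \<lambda>c\<^sub>1\<^sup>2)\<close>.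

  Two coefficient estimates for functions bounded by \<open>1\<close> control the last two terms:
  \<open>|c\<^sub>1| \<le> 1 - |c\<^sub>0|\<^sup>2\<close> (Schwarz-Pick, lemma \<open>schwarz_pick_coeff\<close>) and
  \<open>|c\<^sub>0c\<^sub>2| + |c\<^sub>1|\<^sup>2 \<le> 1 - |c\<^sub>0|\<^sup>2\<close> (lemma \<open>bounded_coeff_hankel\<close>). Both come from Schur's
  algorithm, which replaces a bounded function by another bounded function whose coefficients
  parametrise those of the first.

  With \<open>x = |c\<^sub>0|\<^sup>2 \<in> [0,1]\<close>, \<open>A = |\<Phi>\<^sub>1(\<psi>,\<lambda>)|\<close>, \<open>B = |1-\<lambda>||\<beta>\<^sub>1\<beta>\<^sub>2|\<close> and
  \<open>C = C(\<beta>\<^sub>1,\<lambda>)\<close> this yields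
  \<open>|\<Phi>\<^sub>2(F,\<lambda>)| \<le> A x\<^sup>2 + 2 B x(1-x) + C (1-x) = A x\<^sup>2 + (B + C/2) 2x(1-x) + C (1-x)\<^sup>2\<close>.
  The weights \<open>x\<^sup>2\<close>, \<open>2x(1-x)\<close>, \<open>(1-x)\<^sup>2\<close> add up to \<open>1\<close>, so the right-hand side is a convex
  combination of the three numbers in the maximum.
\<close>

section \<open>Schur's algorithm and coefficients of bounded functions\<close>

lemma taylor_coeff_eqI: "f has_fps_expansion G \<Longrightarrow> taylor_coeff f k = fps_nth G k"
  by (simp add: taylor_coeff_def fps_expansion_eqI)

lemma taylor_coeff_0: "taylor_coeff f 0 = f 0"
  by (simp add: taylor_coeff_def fps_expansion_def)

lemma holomorphic_has_fps_expansion_Abs: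
  assumes "f holomorphic_on unit_disk"
  shows "f has_fps_expansion Abs_fps (taylor_coeff f)"
proof -
  have "Abs_fps (taylor_coeff f) = fps_expansion f 0"
    by (simp add: fps_eq_iff taylor_coeff_def)
  moreover have "f has_fps_expansion fps_expansion f 0"
    using assms by (intro has_fps_expansion_fps_expansion[of unit_disk]) auto
  ultimately show ?thesis by simp
qed

lemma has_fps_expansion_transfer_unit_disk:
  assumes "f has_fps_expansion A" and "\<And>z. z \<in> unit_disk \<Longrightarrow> f z = g z"
  shows "g has_fps_expansion A"
proof -
  have "eventually (\<lambda>z. z \<in> unit_disk) (nhds (0::complex))"
    by (rule eventually_nhds_in_open) auto
  then have "eventually (\<lambda>z. f z = g z) (nhds 0)"
    by (rule eventually_mono) (rule assms(2))
  from has_fps_expansion_cong[OF this refl] assms(1) show ?thesis by blast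
qed

lemma bounded_by_1_cases:
  assumes "f holomorphic_on unit_disk" and le: "\<And>z. z \<in> unit_disk \<Longrightarrow> norm (f z) \<le> 1"
  shows "(\<forall>z\<in>unit_disk. f z = f 0) \<or> (\<forall>z\<in>unit_disk. norm (f z) < 1)"
proof (rule disjCI)
  assume "\<not> (\<forall>z\<in>unit_disk. norm (f z) < 1)"
  then obtain w where w: "w \<in> unit_disk" "norm (f w) = 1"
    using le by force
  have "f constant_on unit_disk"
    by (rule maximum_modulus_principle[of f unit_disk unit_disk w]) (use assms w in auto)
  then show "\<forall>z\<in>unit_disk. f z = f 0"
    by (auto simp: constant_on_def)
qed

text \<open>
  The function \<open>g\<close> is the Schwarz quotient by \<open>z\<close> of the Moebius transform
  \<open>(f - a) / (1 - cnj a * f)\<close>, where \<open>a = f 0\<close>. Cleared of denominators, the relation also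
  covers the unimodular constants, where the transform is undefined and \<open>g = 0\<close> serves.
\<close>
lemma schur_step:
  assumes holf: "f holomorphic_on unit_disk"
    and le: "\<And>z. z \<in> unit_disk \<Longrightarrow> norm (f z) \<le> 1"
  obtains g where "g holomorphic_on unit_disk" "\<And>z. z \<in> unit_disk \<Longrightarrow> norm (g z) \<le> 1"
    "\<And>z. z \<in> unit_disk \<Longrightarrow> f z = f 0 + z * g z * (1 - cnj (f 0) * f z)"
proof (cases "\<forall>z\<in>unit_disk. f z = f 0")
  case True
  show ?thesis
  proof (rule that[of "\<lambda>_. 0"])
    fix z :: complex assume "z \<in> unit_disk"
    from bspec[OF True this] show "f z = f 0 + z * 0 * (1 - cnj (f 0) * f z)" by simp
  qed auto
next
  case False
  then have lt: "norm (f z) < 1" if "z \<in> unit_disk" for z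
    using bounded_by_1_cases[OF holf] le that by blast
  then have lt0: "norm (f 0) < 1" by simp
  define h where "h = Moebius_function 0 (f 0) \<circ> f"
  have holh: "h holomorphic_on unit_disk"
    unfolding h_def
    by (rule holomorphic_on_compose_gen[OF holf Moebius_function_holomorphic[OF lt0]])
      (use lt in auto)
  have h0: "h 0 = 0" by (simp add: h_def Moebius_function_eq_zero)
  have hlt: "norm (h z) < 1" if "norm z < 1" for z
    using Moebius_function_norm_lt_1[OF lt0] lt that by (simp add: h_def)
  obtain g where g: "g holomorphic_on unit_disk"
    "\<And>z. norm z < 1 \<Longrightarrow> h z = z * g z" "deriv h 0 = g 0"
    using Schwarz3[OF holh h0] by blast
  show ?thesis
  proof (rule that[of g])
    show "g holomorphic_on unit_disk" by fact
  next
    fix z :: complex assume z: "z \<in> unit_disk"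
    show "norm (g z) \<le> 1"
    proof (cases "z = 0")
      case True
      then show ?thesis using Schwarz_Lemma(2)[OF holh h0 hlt, of 0] g(3) by simp
    next
      case False
      have "norm z * norm (g z) \<le> norm z * 1"
        using Schwarz_Lemma(1)[OF holh h0 hlt, of z] g(2)[of z] z by (simp add: norm_mult)
      then show ?thesis using False by simp
    qed
    have "norm (cnj (f 0) * f z) < 1"
      using norm_mult_less[of "cnj (f 0)" 1 "f z" 1] lt[OF z] lt0 by simp
    then have "1 - cnj (f 0) * f z \<noteq> 0" by auto
    moreover have "(f z - f 0) / (1 - cnj (f 0) * f z) = z * g z"
      using g(2)[of z] z by (simp add: h_def Moebius_function_simple)
    ultimately have "f z - f 0 = z * g z * (1 - cnj (f 0) * f z)"
      by (simp add: nonzero_divide_eq_eq)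
    then show "f z = f 0 + z * g z * (1 - cnj (f 0) * f z)"
      by (simp only: diff_eq_eq add.commute)
  qed
qed

lemma schur_step_coeffs:
  assumes holf: "f holomorphic_on unit_disk"
    and le: "\<And>z. z \<in> unit_disk \<Longrightarrow> norm (f z) \<le> 1"
  obtains g where "g holomorphic_on unit_disk" "\<And>z. z \<in> unit_disk \<Longrightarrow> norm (g z) \<le> 1"
    "taylor_coeff f 1 = taylor_coeff g 0 * of_real (1 - (norm (f 0))\<^sup>2)"
    "taylor_coeff f 2 = taylor_coeff g 1 * of_real (1 - (norm (f 0))\<^sup>2)
       - cnj (f 0) * taylor_coeff g 0 * taylor_coeff f 1"
proof -
  obtain g where g: "g holomorphic_on unit_disk" "\<And>z. z \<in> unit_disk \<Longrightarrow> norm (g z) \<le> 1"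
    and eq: "\<And>z. z \<in> unit_disk \<Longrightarrow> f z = f 0 + z * g z * (1 - cnj (f 0) * f z)"
    using schur_step[OF holf le] by blast
  define P where "P = Abs_fps (taylor_coeff f)"
  define G where "G = Abs_fps (taylor_coeff g)"
  define R where "R = fps_const (f 0) + fps_X * G * (1 - fps_const (cnj (f 0)) * P)"
  have P: "f has_fps_expansion P" and G: "g has_fps_expansion G"
    unfolding P_def G_def using holf g(1) by (auto intro: holomorphic_has_fps_expansion_Abs)
  have "(\<lambda>z. f 0 + z * g z * (1 - cnj (f 0) * f z)) has_fps_expansion R"
    unfolding R_def by (intro fps_expansion_intros P G)
  then have R: "f has_fps_expansion R"
    using eq[symmetric] by (rule has_fps_expansion_transfer_unit_disk)
  have sq: "of_real (1 - (norm (f 0))\<^sup>2) = 1 - cnj (f 0) * f 0"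
    by (simp add: complex_norm_square mult.commute del: of_real_power)
  have 1: "taylor_coeff f 1 = taylor_coeff g 0 * (1 - cnj (f 0) * f 0)"
    unfolding taylor_coeff_eqI[OF R]
    by (simp add: R_def P_def G_def mult.assoc taylor_coeff_0)
  have 2: "taylor_coeff f 2 = taylor_coeff g 1 * (1 - cnj (f 0) * f 0)
      - cnj (f 0) * taylor_coeff g 0 * taylor_coeff f 1"
    unfolding taylor_coeff_eqI[OF R, of 2]
    by (simp add: R_def P_def G_def mult.assoc taylor_coeff_0 fps_mult_nth numeral_2_eq_2)
  show ?thesis using that[OF g] 1 2 unfolding sq by blast
qed

lemma schwarz_pick_coeff:
  assumes "f holomorphic_on unit_disk" and "\<And>z. z \<in> unit_disk \<Longrightarrow> norm (f z) \<le> 1"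
  shows "norm (taylor_coeff f 1) \<le> 1 - (norm (f 0))\<^sup>2"
proof -
  obtain g where g: "\<And>z. z \<in> unit_disk \<Longrightarrow> norm (g z) \<le> 1"
    "taylor_coeff f 1 = taylor_coeff g 0 * of_real (1 - (norm (f 0))\<^sup>2)"
    using schur_step_coeffs[OF assms] by metis
  have "(norm (f 0))\<^sup>2 \<le> 1" using assms(2)[of 0] by (simp add: power_le_one)
  moreover have "norm (taylor_coeff g 0) \<le> 1" using g(1)[of 0] by (simp add: taylor_coeff_0)
  ultimately show ?thesis
    unfolding g(2) norm_mult norm_of_real by (simp add: mult_left_le_one_le)
qed

text \<open>
  Let \<open>p = |f 0|\<close>. One Schur step expresses the coefficients of \<open>f\<close> by those of a bounded
  function \<open>g\<close>, and Schwarz-Pick for \<open>g\<close>, with \<open>t = |g 0|\<close>, bounds the left-hand side by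
  \<open>(1 - p\<^sup>2) (p (1 - t\<^sup>2) + p\<^sup>2 t\<^sup>2 + (1 - p\<^sup>2) t\<^sup>2)\<close>. The second factor is
  \<open>p (1 - t\<^sup>2) + t\<^sup>2\<close>, which is at most \<open>1\<close> because \<open>p \<le> 1\<close>.
\<close>
lemma bounded_coeff_hankel:
  assumes "f holomorphic_on unit_disk" and "\<And>z. z \<in> unit_disk \<Longrightarrow> norm (f z) \<le> 1"
  shows "norm (f 0 * taylor_coeff f 2) + (norm (taylor_coeff f 1))\<^sup>2 \<le> 1 - (norm (f 0))\<^sup>2"
proof -
  obtain g where g: "g holomorphic_on unit_disk" "\<And>z. z \<in> unit_disk \<Longrightarrow> norm (g z) \<le> 1"
    and c1: "taylor_coeff f 1 = taylor_coeff g 0 * of_real (1 - (norm (f 0))\<^sup>2)"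
    and c2: "taylor_coeff f 2 = taylor_coeff g 1 * of_real (1 - (norm (f 0))\<^sup>2)
       - cnj (f 0) * taylor_coeff g 0 * taylor_coeff f 1"
    using schur_step_coeffs[OF assms] by metis
  define p t s where "p = norm (f 0)" and "t = norm (g 0)" and "s = 1 - p\<^sup>2"
  have p: "0 \<le> p" "p \<le> 1" using assms(2)[of 0] by (auto simp: p_def)
  then have s: "0 \<le> s" by (simp add: s_def power_le_one)
  have t: "t\<^sup>2 \<le> 1" using g(2)[of 0] by (simp add: t_def power_le_one)
  have g1: "norm (taylor_coeff g 1) \<le> 1 - t\<^sup>2"
    unfolding t_def by (rule schwarz_pick_coeff[OF g])
  have n1: "norm (taylor_coeff f 1) = t * s"
    using s unfolding c1 norm_mult norm_of_real by (simp add: taylor_coeff_0 t_def s_def p_def)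
  have "norm (taylor_coeff f 2) \<le> norm (taylor_coeff g 1 * of_real s)
      + norm (cnj (f 0) * taylor_coeff g 0 * taylor_coeff f 1)"
    unfolding c2 s_def p_def by (rule norm_triangle_ineq4)
  also have "\<dots> = norm (taylor_coeff g 1) * s + p * t * (t * s)"
    using s n1 by (simp add: norm_mult taylor_coeff_0 t_def p_def)
  also have "\<dots> \<le> (1 - t\<^sup>2) * s + p * t * (t * s)"
    using g1 s by (simp add: mult_right_mono)
  finally have "norm (f 0 * taylor_coeff f 2) \<le> p * ((1 - t\<^sup>2) * s + p * t * (t * s))"
    using p by (simp add: norm_mult p_def mult_left_mono)
  then have "norm (f 0 * taylor_coeff f 2) + (norm (taylor_coeff f 1))\<^sup>2
      \<le> p * ((1 - t\<^sup>2) * s + p * t * (t * s)) + (t * s)\<^sup>2"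
    unfolding n1 by simp
  also have "\<dots> = s * (p * (1 - t\<^sup>2) + t\<^sup>2)"
    by (simp add: s_def power2_eq_square algebra_simps)
  also have "\<dots> \<le> s * (1 * (1 - t\<^sup>2) + t\<^sup>2)"
    using p t s by (intro mult_left_mono add_right_mono mult_right_mono) auto
  finally show ?thesis by (simp add: s_def p_def)
qed

section \<open>The determinant as a convex combination\<close>

text \<open>
  Because the inner function \<open>z \<phi>(z)\<close> vanishes at \<open>0\<close>, each coefficient of the composition is
  a finite sum, and those of \<open>F\<close> are \<open>b\<^sub>1c\<^sub>0\<close>, \<open>b\<^sub>1c\<^sub>1 + b\<^sub>2c\<^sub>0\<^sup>2\<close> and
  \<open>b\<^sub>1c\<^sub>2 + 2b\<^sub>2c\<^sub>0c\<^sub>1 + b\<^sub>3c\<^sub>0\<^sup>3\<close> at \<open>z\<^sup>2\<close>, \<open>z\<^sup>3\<close> and \<open>z\<^sup>4\<close>.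
\<close>
lemma Phi_2_shift_compose:
  fixes \<psi> \<phi> F :: "complex \<Rightarrow> complex" and lam :: complex
  assumes hol: "\<psi> holomorphic_on unit_disk" "\<phi> holomorphic_on unit_disk"
    and F: "\<And>z. z \<in> unit_disk \<Longrightarrow> F z = z * \<psi> (z * \<phi> z)"
  defines "b \<equiv> taylor_coeff \<psi>" and "c \<equiv> taylor_coeff \<phi>"
  shows "Phi 2 F lam = Phi 1 \<psi> lam * c 0 ^ 4 + 2 * (1 - lam) * (b 1 * b 2) * ((c 0)\<^sup>2 * c 1)
    + (b 1)\<^sup>2 * (c 0 * c 2 - lam * (c 1)\<^sup>2)"
proof -
  define B W where "B = Abs_fps b" and "W = fps_X * Abs_fps c"
  have B: "\<psi> has_fps_expansion B" and "\<phi> has_fps_expansion Abs_fps c"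
    unfolding B_def b_def c_def using hol by (auto intro: holomorphic_has_fps_expansion_Abs)
  then have W: "(\<lambda>z. z * \<phi> z) has_fps_expansion W"
    unfolding W_def by (intro fps_expansion_intros)
  have "(\<psi> \<circ> (\<lambda>z. z * \<phi> z)) has_fps_expansion fps_compose B W"
    by (rule has_fps_expansion_compose[OF B W]) (simp add: W_def)
  then have "(\<lambda>z. z * (\<psi> \<circ> (\<lambda>z. z * \<phi> z)) z) has_fps_expansion fps_X * fps_compose B W"
    by (rule has_fps_expansion_mult[OF has_fps_expansion_fps_X])
  then have "F has_fps_expansion fps_X * fps_compose B W"
    by (rule has_fps_expansion_transfer_unit_disk) (simp add: F)
  then have coeff: "taylor_coeff F (Suc k) = fps_nth (fps_compose B W) k" for k
    by (simp add: taylor_coeff_eqI)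
  have W_nth: "fps_nth W 0 = 0" "fps_nth W (Suc k) = c k" for k
    by (simp_all add: W_def)
  have a2: "taylor_coeff F 2 = b 1 * c 0"
    using coeff[of 1] by (simp add: fps_compose_nth B_def W_nth numeral_2_eq_2)
  have a3: "taylor_coeff F 3 = b 1 * c 1 + b 2 * (c 0)\<^sup>2"
    using coeff[of 2]
    by (simp add: fps_compose_nth B_def W_nth eval_nat_numeral fps_mult_nth)
  have a4: "taylor_coeff F 4 = b 1 * c 2 + 2 * b 2 * c 0 * c 1 + b 3 * c 0 ^ 3"
    using coeff[of 3]
    by (simp add: fps_compose_nth B_def W_nth eval_nat_numeral fps_mult_nth algebra_simps)
  have "Phi 2 F lam = taylor_coeff F 2 * taylor_coeff F 4 - lam * (taylor_coeff F 3)\<^sup>2"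
    and "Phi 1 \<psi> lam = b 1 * b 3 - lam * (b 2)\<^sup>2"
    by (simp_all add: Phi_def b_def eval_nat_numeral)
  then show ?thesis
    unfolding a2 a3 a4 by algebra
qed

lemma quadratic_weights_le_max:
  fixes A B C x :: real
  assumes "0 \<le> x" "x \<le> 1"
  shows "A * x\<^sup>2 + 2 * B * (x * (1 - x)) + C * (1 - x) \<le> max A (max (B + C / 2) C)"
    (is "_ \<le> ?M")
proof -
  have "A * x\<^sup>2 + 2 * B * (x * (1 - x)) + C * (1 - x)
      = A * x\<^sup>2 + (B + C / 2) * (2 * x * (1 - x)) + C * (1 - x)\<^sup>2"
    by (simp add: power2_eq_square field_simps)
  also have "\<dots> \<le> ?M * x\<^sup>2 + ?M * (2 * x * (1 - x)) + ?M * (1 - x)\<^sup>2"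
    using assms by (intro add_mono mult_right_mono) auto
  also have "\<dots> = ?M * (x\<^sup>2 + 2 * x * (1 - x) + (1 - x)\<^sup>2)"
    by (simp only: distrib_left)
  also have "x\<^sup>2 + 2 * x * (1 - x) + (1 - x)\<^sup>2 = 1"
    by (simp add: power2_eq_square algebra_simps)
  finally show ?thesis by simp
qed

theorem theorem5p4:
  fixes \<psi> F :: "complex \<Rightarrow> complex" and \<beta> :: "nat \<Rightarrow> complex" and lam :: complex
  assumes "\<psi> holomorphic_on unit_disk"
    and "\<And>z. z \<in> unit_disk \<Longrightarrow> (\<lambda>k. \<beta> k * z ^ k) sums \<psi> z"
    and "\<beta> 0 \<noteq> 0"
    and "F \<in> class_A_Id \<psi>"
  shows "norm (Phi 2 F lam) \<le>
    max (norm (Phi 1 \<psi> lam))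
      (max (norm (1 - lam) * norm (\<beta> 1 * \<beta> 2) + C_const (\<beta> 1) lam / 2)
           (C_const (\<beta> 1) lam))"
proof -
  have "eventually (\<lambda>u. (\<lambda>n. fps_nth (Abs_fps \<beta>) n * u ^ n) sums \<psi> u) (nhds 0)"
    using eventually_nhds_in_open[of unit_disk 0] assms(2) by (auto elim: eventually_mono)
  then have \<beta>: "taylor_coeff \<psi> = \<beta>"
    using taylor_coeff_eqI[OF has_fps_expansionI] by fastforce
  obtain \<omega> where \<omega>: "\<omega> holomorphic_on unit_disk" "\<omega> ` unit_disk \<subseteq> unit_disk" "\<omega> 0 = 0"
    and F: "\<And>z. z \<in> unit_disk \<Longrightarrow> F z = z * \<psi> (\<omega> z)"
    using assms(4) by (auto simp: class_A_Id_def)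
  have "norm (\<omega> z) \<le> 1" if "z \<in> unit_disk" for z
    using \<omega>(2) that by (force simp: image_subset_iff)
  \<comment> \<open>As \<open>\<omega> 0 = 0\<close>, the Schur step is division by \<open>z\<close>.\<close>
  then obtain \<phi> where \<phi>: "\<phi> holomorphic_on unit_disk"
      "\<And>z. z \<in> unit_disk \<Longrightarrow> norm (\<phi> z) \<le> 1"
    and \<omega>\<phi>: "\<And>z. z \<in> unit_disk \<Longrightarrow> \<omega> z = z * \<phi> z"
    using schur_step[OF \<omega>(1)] \<omega>(3) by auto
  define c where "c = taylor_coeff \<phi>"
  define x where "x = (norm (c 0))\<^sup>2"
  define C where "C = C_const (\<beta> 1) lam"
  have Phi2: "Phi 2 F lam = Phi 1 \<psi> lam * c 0 ^ 4
      + 2 * (1 - lam) * (\<beta> 1 * \<beta> 2) * ((c 0)\<^sup>2 * c 1)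
      + (\<beta> 1)\<^sup>2 * (c 0 * c 2 - lam * (c 1)\<^sup>2)"
    unfolding c_def \<beta>[symmetric]
    by (rule Phi_2_shift_compose[OF assms(1) \<phi>(1)]) (simp add: F \<omega>\<phi>)
  have x: "0 \<le> x" "x \<le> 1"
    using \<phi>(2)[of 0] by (auto simp: x_def c_def taylor_coeff_0 power_le_one)
  have c1: "norm (c 1) \<le> 1 - x"
    using schwarz_pick_coeff[OF \<phi>] by (simp add: x_def c_def taylor_coeff_0)
  have hankel: "norm (c 0 * c 2) + (norm (c 1))\<^sup>2 \<le> 1 - x"
    using bounded_coeff_hankel[OF \<phi>] by (simp add: x_def c_def taylor_coeff_0)
  have "norm (c 0 * c 2 - lam * (c 1)\<^sup>2) \<le> 1 * norm (c 0 * c 2) + norm lam * (norm (c 1))\<^sup>2"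
    using norm_triangle_ineq4[of "c 0 * c 2" "lam * (c 1)\<^sup>2"]
    by (simp add: norm_mult norm_power)
  also have "\<dots> \<le> max 1 (norm lam) * norm (c 0 * c 2) + max 1 (norm lam) * (norm (c 1))\<^sup>2"
    by (intro add_mono mult_right_mono) auto
  also have "\<dots> \<le> max 1 (norm lam) * (1 - x)"
    unfolding distrib_left[symmetric] by (rule mult_left_mono[OF hankel]) simp
  finally have last: "norm ((\<beta> 1)\<^sup>2 * (c 0 * c 2 - lam * (c 1)\<^sup>2)) \<le> C * (1 - x)"
    by (simp add: C_def C_const_def norm_mult norm_power mult.assoc mult_left_mono)
  have "norm (2 * (1 - lam) * (\<beta> 1 * \<beta> 2) * ((c 0)\<^sup>2 * c 1))
      = 2 * (norm (1 - lam) * norm (\<beta> 1 * \<beta> 2)) * (x * norm (c 1))"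
    unfolding norm_mult norm_power by (simp add: x_def)
  also have "\<dots> \<le> 2 * (norm (1 - lam) * norm (\<beta> 1 * \<beta> 2)) * (x * (1 - x))"
    using c1 x by (intro mult_left_mono) auto
  finally have middle: "norm (2 * (1 - lam) * (\<beta> 1 * \<beta> 2) * ((c 0)\<^sup>2 * c 1))
      \<le> 2 * (norm (1 - lam) * norm (\<beta> 1 * \<beta> 2)) * (x * (1 - x))" .
  have first: "norm (Phi 1 \<psi> lam * c 0 ^ 4) = norm (Phi 1 \<psi> lam) * x\<^sup>2"
    by (simp add: norm_mult norm_power x_def flip: power_mult)
  have "norm (Phi 2 F lam) \<le> norm (Phi 1 \<psi> lam) * x\<^sup>2
      + 2 * (norm (1 - lam) * norm (\<beta> 1 * \<beta> 2)) * (x * (1 - x)) + C * (1 - x)"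
    unfolding Phi2 using first middle last by (intro norm_triangle_mono) auto
  also have "\<dots> \<le> max (norm (Phi 1 \<psi> lam))
      (max (norm (1 - lam) * norm (\<beta> 1 * \<beta> 2) + C / 2) C)"
    by (rule quadratic_weights_le_max[OF x])
  finally show ?thesis unfolding C_def .
qed

end
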